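(* Let $n,k$ be positive integers, and let $(Q,\cdot)$, $Q=\{1,\ldots,n\}$, be a naturally ordered groupoid of order $n$ with multiplication $x\cdot y=[ax+by]_n$, where $a,b\in\mathbb{Z}_n$, $[a+b]_n=1$ and $[a+bk]_n=0$. Then $(Q,\cdot)$ is a $k$-translatable quasigroup that is (1) quadratical if and only if $[2a^2-2a+1]_n=0$; (2) hexagonal if and only if $[a^2-a+1]_n=0$; (3) a $GS$-quasigroup if and only if $[a^2-a-1]_n=0$; (4) a right modular quasigroup if and only if $[a^2+a-1]_n=0$; (5) a left modular quasigroup if and only if $[a^2-3a+1]_n=0$; (6) a Stein quasigroup if and only if $[a^2-3a+1]_n=0$; (7) an $ARO$-quasigroup if and only if $[2a^2]_n=1$; (8) a $C3$ quasigroup if and only if $[a^3]_n=1$.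
   Context: For an integer $m$, $[m]_n$ is the element of $\{1,\ldots,n\}$ congruent to $m$ modulo $n$, with $0=n$; an equation $[u]_n=v$ with $v$ an integer means $u\equiv v\pmod n$. A groupoid is a set with a binary operation; it is a quasigroup if $ax=b$ and $xa=b$ are uniquely solvable for $x$. A groupoid on $\{1,\ldots,n\}$ is $k$-translatable if $i\cdot j=[i+1]_n\cdot[j+k]_n$ for all $i,j$. Juxtaposition binds tighter than the dot. Idempotent means $x\cdot x=x$; medial means $xy\cdot zw=xz\cdot yw$. A quasigroup is: - quadratical if $xy\cdot x=zx\cdot yz$; - hexagonal if it is idempotent, medial and $x\cdot yx=y$; - a $GS$-quasigroup if it is idempotent and satisfies the (mutually equivalent) identities $x(xy\cdot z)\cdot z=y$ and $x\cdot(x\cdot yz)z=y$; - right modular if $xy\cdot z=zy\cdot x$; - left modular if $x\cdot yz=z\cdot yx$; - Stein if $x\cdot xy=yx$; - $ARO$ if it is idempotent, medial and $xy\cdot y=yx\cdot x$; - $C3$ if it is idempotent and $(xy\cdot y)y=x$. *)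

theory Defs
  imports "HOL-Number_Theory.Cong"
begin

text \<open>The representative of \<open>m\<close> modulo \<open>n\<close> in \<open>{1..n}\<close> (rather than \<open>{0..<n}\<close>), so that
  multiples of \<open>n\<close> are represented by \<open>n\<close>; see \<open>residue_rep_unique\<close>.\<close>

definition residue_rep :: "int \<Rightarrow> int \<Rightarrow> int" where
  "residue_rep n m = (m - 1) mod n + 1"

lemma residue_rep_unique:
  fixes n m r :: int
  assumes "n > 0"
  shows "r = residue_rep n m \<longleftrightarrow> r \<in> {1..n} \<and> [r = m] (mod n)"
proof
  assume r: "r = residue_rep n m"
  have "0 \<le> (m - 1) mod n" and "(m - 1) mod n < n"
    using assms by simp_all
  moreover have "[(m - 1) mod n + 1 = (m - 1) + 1] (mod n)"
    by (intro cong_add) (simp_all add: cong_def)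
  ultimately show "r \<in> {1..n} \<and> [r = m] (mod n)"
    using r by (simp add: residue_rep_def)
next
  assume r: "r \<in> {1..n} \<and> [r = m] (mod n)"
  then have "(r - 1) mod n = (m - 1) mod n"
    by (metis cong_def cong_diff cong_refl)
  moreover have "(r - 1) mod n = r - 1"
    using r by simp
  ultimately show "r = residue_rep n m"
    by (simp add: residue_rep_def)
qed

locale groupoid =
  fixes Q :: "'a set" and mult :: "'a \<Rightarrow> 'a \<Rightarrow> 'a" (infixl "\<cdot>" 70)
  assumes closed: "\<lbrakk>x \<in> Q; y \<in> Q\<rbrakk> \<Longrightarrow> x \<cdot> y \<in> Q"

locale k_translatable_groupoid = groupoid "{1..n}" mult
  for n :: int and k :: int and mult (infixl "\<cdot>" 70) +
  assumes translatable:
    "\<lbrakk>i \<in> {1..n}; j \<in> {1..n}\<rbrakk> \<Longrightarrow> i \<cdot> j = residue_rep n (i + 1) \<cdot> residue_rep n (j + k)"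

locale quasigroup = groupoid +
  assumes right_div: "\<lbrakk>a \<in> Q; b \<in> Q\<rbrakk> \<Longrightarrow> \<exists>!x. x \<in> Q \<and> a \<cdot> x = b"
    and left_div: "\<lbrakk>a \<in> Q; b \<in> Q\<rbrakk> \<Longrightarrow> \<exists>!x. x \<in> Q \<and> x \<cdot> a = b"

locale idempotent_quasigroup = quasigroup +
  assumes idempotent: "x \<in> Q \<Longrightarrow> x \<cdot> x = x"

locale medial_quasigroup = quasigroup +
  assumes medial:
    "\<lbrakk>x \<in> Q; y \<in> Q; z \<in> Q; w \<in> Q\<rbrakk> \<Longrightarrow> (x \<cdot> y) \<cdot> (z \<cdot> w) = (x \<cdot> z) \<cdot> (y \<cdot> w)"

locale quadratical_quasigroup = quasigroup +
  assumes quadratical: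
    "\<lbrakk>x \<in> Q; y \<in> Q; z \<in> Q\<rbrakk> \<Longrightarrow> (x \<cdot> y) \<cdot> x = (z \<cdot> x) \<cdot> (y \<cdot> z)"

locale hexagonal_quasigroup = idempotent_quasigroup + medial_quasigroup +
  assumes semisymmetric: "\<lbrakk>x \<in> Q; y \<in> Q\<rbrakk> \<Longrightarrow> x \<cdot> (y \<cdot> x) = y"

locale GS_quasigroup = idempotent_quasigroup +
  assumes GS1: "\<lbrakk>x \<in> Q; y \<in> Q; z \<in> Q\<rbrakk> \<Longrightarrow> (x \<cdot> ((x \<cdot> y) \<cdot> z)) \<cdot> z = y"
    and GS2: "\<lbrakk>x \<in> Q; y \<in> Q; z \<in> Q\<rbrakk> \<Longrightarrow> x \<cdot> ((x \<cdot> (y \<cdot> z)) \<cdot> z) = y"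

locale right_modular_quasigroup = quasigroup +
  assumes right_modular:
    "\<lbrakk>x \<in> Q; y \<in> Q; z \<in> Q\<rbrakk> \<Longrightarrow> (x \<cdot> y) \<cdot> z = (z \<cdot> y) \<cdot> x"

locale left_modular_quasigroup = quasigroup +
  assumes left_modular:
    "\<lbrakk>x \<in> Q; y \<in> Q; z \<in> Q\<rbrakk> \<Longrightarrow> x \<cdot> (y \<cdot> z) = z \<cdot> (y \<cdot> x)"

locale Stein_quasigroup = quasigroup +
  assumes Stein: "\<lbrakk>x \<in> Q; y \<in> Q\<rbrakk> \<Longrightarrow> x \<cdot> (x \<cdot> y) = y \<cdot> x"

locale ARO_quasigroup = idempotent_quasigroup + medial_quasigroup +
  assumes ARO: "\<lbrakk>x \<in> Q; y \<in> Q\<rbrakk> \<Longrightarrow> (x \<cdot> y) \<cdot> y = (y \<cdot> x) \<cdot> x"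

locale C3_quasigroup = idempotent_quasigroup +
  assumes C3: "\<lbrakk>x \<in> Q; y \<in> Q\<rbrakk> \<Longrightarrow> ((x \<cdot> y) \<cdot> y) \<cdot> y = x"

end

theory Submission imports Defs begin

text \<open>Since \<open>b \<equiv> 1 - a\<close>, the product is \<open>x \<cdot> y \<equiv> a x + (1 - a) y\<close>. Hence the groupoid is always
  idempotent and medial, and the two sides of each of the remaining identities differ by \<open>P(a)\<close>
  times a linear form whose coefficients sum to \<open>0\<close>, where \<open>P\<close> is the polynomial of the
  corresponding condition. Evaluation at \<open>1\<close> and \<open>n\<close> gives \<open>P(a) \<equiv> 0\<close>
  (in the GS case after cancelling the unit \<open>1 - a\<close>). Conversely, \<open>P(a) \<equiv> 0\<close>
  exhibits an inverse of \<open>a\<close> modulo \<open>n\<close>, while \<open>1 - a\<close> is invertible because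
  \<open>(1 - a)(1 - k) \<equiv> b - b k \<equiv> b + a \<equiv> 1\<close>; so all translations are bijective.\<close>

section \<open>Congruences and their representatives in \<open>{1..n}\<close>\<close>

lemma coprime_if_dvd_diff_one:
  fixes a c n :: int
  assumes "n dvd a * c - 1"
  shows "coprime a n"
proof (rule coprimeI)
  fix d assume "d dvd a" "d dvd n"
  then have "d dvd a * c" "d dvd a * c - 1"
    using assms by (blast intro: dvd_trans dvd_mult2)+
  from dvd_diff[OF this] show "is_unit d" by simp
qed

lemma residue_rep_mem: "n > 0 \<Longrightarrow> residue_rep n m \<in> {1..n}"
  using residue_rep_unique by blast

lemma residue_rep_cong: "n > 0 \<Longrightarrow> [residue_rep n m = m] (mod n)"
  using residue_rep_unique by blast

lemma residue_rep_cong_eq: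
  assumes "[m = m'] (mod n)"
  shows "residue_rep n m = residue_rep n m'"
  using assms unfolding residue_rep_def by (metis cong_def mod_diff_left_eq)

text \<open>Two elements of \<open>{1..n}\<close> are equal as soon as they are congruent, and
  congruence allows each to be replaced by a polynomial expression. This turns every identity of the
  groupoid into a divisibility.\<close>

lemma residue_eq_iff_dvd:
  fixes n u v s t :: int
  assumes "u \<in> {1..n}" "v \<in> {1..n}" "[u = s] (mod n)" "[v = t] (mod n)"
  shows "u = v \<longleftrightarrow> n dvd s - t"
proof -
  have "n > 0" using assms(1) by auto
  have "u = residue_rep n v \<longleftrightarrow> [u = v] (mod n)" "v = residue_rep n v"
    using residue_rep_unique[OF \<open>n > 0\<close>] assms(1,2) cong_refl by blast+
  moreover have "[u = v] (mod n) \<longleftrightarrow> [s = t] (mod n)"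
    using assms(3,4) by (simp add: cong_def)
  ultimately show ?thesis by (simp add: cong_iff_dvd_diff)
qed

lemma ex1_linear_residue:
  fixes n c d e :: int
  assumes "n > 0" "coprime c n"
  shows "\<exists>!x. x \<in> {1..n} \<and> [c * x + d = e] (mod n)"
proof -
  obtain c' where c': "[c * c' = 1] (mod n)"
    using cong_solve_coprime_int[OF assms(2)] by auto
  have "[c * x + d = e] (mod n) \<longleftrightarrow> [x = c' * (e - d)] (mod n)" for x
  proof -
    \<comment> \<open>The factor \<open>1\<close> is a placeholder for \<open>c * c'\<close>, after
      which \<open>c\<close> cancels on both sides.\<close>
    have "[c * x + d = e] (mod n) \<longleftrightarrow> [c * x = 1 * (e - d)] (mod n)"
      by (simp add: cong_iff_dvd_diff algebra_simps)
    also have "\<dots> \<longleftrightarrow> [c * x = (c * c') * (e - d)] (mod n)"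
      using cong_scalar_right[OF c', of "e - d"] by (simp add: cong_def)
    also have "\<dots> \<longleftrightarrow> [x = c' * (e - d)] (mod n)"
      using cong_mult_lcancel[OF assms(2)] by (simp add: mult.assoc)
    finally show ?thesis .
  qed
  then show ?thesis
    using residue_rep_unique[OF assms(1)] by (metis (no_types, lifting))
qed

text \<open>A difference of two variables evaluated at \<open>n\<close> and \<open>1\<close> is
  \<open>n - 1\<close>, a unit congruent to -1, so it cancels from the divisibility.\<close>

lemma dvd_mult_diff_self_iff: "(n::int) dvd P * (n - 1) \<longleftrightarrow> n dvd P"
  by (simp add: right_diff_distrib dvd_diff_right_iff)

section \<open>Affine groupoids with coefficients \<open>a\<close> and \<open>1 - a\<close>\<close>

text \<open>The coefficient \<open>b\<close> is eliminated, and the condition on \<open>k\<close>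
  enters as the coprimality of \<open>1 - a\<close> with \<open>n\<close>. Invertibility of
  \<open>a\<close> is not assumed: each polynomial condition has to supply it.\<close>

locale affine_groupoid =
  fixes n a :: int and mult :: "int \<Rightarrow> int \<Rightarrow> int" (infixl "\<cdot>" 70)
  assumes n_pos: "n > 0"
    and mult_eq: "\<lbrakk>x \<in> {1..n}; y \<in> {1..n}\<rbrakk> \<Longrightarrow> x \<cdot> y = residue_rep n (a * x + (1 - a) * y)"
    and coprime_right: "coprime (1 - a) n"
begin

abbreviation Q :: "int set" where "Q \<equiv> {1..n}"

lemma mult_closed: "\<lbrakk>x \<in> Q; y \<in> Q\<rbrakk> \<Longrightarrow> x \<cdot> y \<in> Q"
  using mult_eq residue_rep_mem[OF n_pos] by simp

text \<open>Applied recursively along a nested product, this rewrites the product as a polynomial in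
  its variables modulo \<open>n\<close>.\<close>

lemma mult_cong:
  assumes "x \<in> Q" "y \<in> Q" "[x = s] (mod n)" "[y = t] (mod n)"
  shows "[x \<cdot> y = a * s + (1 - a) * t] (mod n)"
proof -
  have "[x \<cdot> y = a * x + (1 - a) * y] (mod n)"
    using assms mult_eq residue_rep_cong[OF n_pos] by simp
  also have "[a * x + (1 - a) * y = a * s + (1 - a) * t] (mod n)"
    using assms by (intro cong_add cong_mult cong_refl)
  finally show ?thesis .
qed

lemma one_mem: "1 \<in> Q" and n_mem: "n \<in> Q"
  using n_pos by auto

text \<open>Both division equations are linear congruences. Solving for the right factor needs
  \<open>1 - a\<close> to be a unit, which \<open>coprime_right\<close> gives; solving for the left
  factor needs \<open>a\<close> to be a unit, with inverse \<open>c\<close>.\<close>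

lemma quasigroupI:
  assumes "n dvd a * c - 1"
  shows "quasigroup Q mult"
proof
  fix u v assume uv: "u \<in> Q" "v \<in> Q"
  have "u \<cdot> x = v \<longleftrightarrow> [(1 - a) * x + a * u = v] (mod n)" if "x \<in> Q" for x
    using residue_eq_iff_dvd[OF mult_closed[OF uv(1) that] uv(2)
        mult_cong[OF uv(1) that cong_refl cong_refl] cong_refl]
    by (simp add: cong_iff_dvd_diff algebra_simps)
  then show "\<exists>!x. x \<in> Q \<and> u \<cdot> x = v"
    using ex1_linear_residue[OF n_pos coprime_right] by (metis (no_types, lifting))
  have "x \<cdot> u = v \<longleftrightarrow> [a * x + (1 - a) * u = v] (mod n)" if "x \<in> Q" for x
    using residue_eq_iff_dvd[OF mult_closed[OF that uv(1)] uv(2)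
        mult_cong[OF that uv(1) cong_refl cong_refl] cong_refl]
    by (simp add: cong_iff_dvd_diff algebra_simps)
  then show "\<exists>!x. x \<in> Q \<and> x \<cdot> u = v"
    using ex1_linear_residue[OF n_pos coprime_if_dvd_diff_one[OF assms]]
    by (metis (no_types, lifting))
qed (rule mult_closed)

lemma mult_idem:
  assumes "x \<in> Q"
  shows "x \<cdot> x = x"
  using residue_eq_iff_dvd[OF mult_closed[OF assms assms] assms
      mult_cong[OF assms assms cong_refl cong_refl] cong_refl]
  by (simp add: algebra_simps)

lemma idempotent_quasigroupI:
  assumes "n dvd a * c - 1"
  shows "idempotent_quasigroup Q mult"
  using quasigroupI[OF assms] mult_idem
  by (intro idempotent_quasigroup.intro idempotent_quasigroup_axioms.intro)

text \<open>Both sides expand to \<open>a^2 * x + a * (1 - a) * (y + z) + (1 - a)^2 * w\<close>,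
  which is symmetric in \<open>y\<close> and \<open>z\<close>.\<close>

lemma medial_quasigroupI:
  assumes "n dvd a * c - 1"
  shows "medial_quasigroup Q mult"
proof (intro medial_quasigroup.intro medial_quasigroup_axioms.intro quasigroupI[OF assms])
  fix x y z w assume mem: "x \<in> Q" "y \<in> Q" "z \<in> Q" "w \<in> Q"
  have "[x \<cdot> y \<cdot> (z \<cdot> w) = a * (a * x + (1 - a) * y) + (1 - a) * (a * z + (1 - a) * w)] (mod n)"
    and "[x \<cdot> z \<cdot> (y \<cdot> w) = a * (a * x + (1 - a) * z) + (1 - a) * (a * y + (1 - a) * w)] (mod n)"
    by (intro mult_cong mult_closed mem cong_refl)+
  from residue_eq_iff_dvd[OF _ _ this] mem show "x \<cdot> y \<cdot> (z \<cdot> w) = x \<cdot> z \<cdot> (y \<cdot> w)"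
    by (simp add: mult_closed algebra_simps del: atLeastAtMost_iff)
qed

section \<open>The identities as divisibility conditions\<close>

text \<open>The variable \<open>y\<close> has coefficient \<open>a * (1 - a)\<close> on both sides
  and cancels.\<close>

lemma quadratical_iff:
  assumes "x \<in> Q" "y \<in> Q" "z \<in> Q"
  shows "(x \<cdot> y) \<cdot> x = (z \<cdot> x) \<cdot> (y \<cdot> z) \<longleftrightarrow> n dvd (2 * a^2 - 2 * a + 1) * (x - z)"
proof -
  have eqs: "[(x \<cdot> y) \<cdot> x = a * (a * x + (1 - a) * y) + (1 - a) * x] (mod n)"
    "[(z \<cdot> x) \<cdot> (y \<cdot> z) = a * (a * z + (1 - a) * x) + (1 - a) * (a * y + (1 - a) * z)] (mod n)"
    by (intro mult_cong mult_closed assms cong_refl)+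
  have "(x \<cdot> y) \<cdot> x \<in> Q" "(z \<cdot> x) \<cdot> (y \<cdot> z) \<in> Q"
    by (intro mult_closed assms)+
  note residue_eq_iff_dvd[OF this eqs]
  also have "a * (a * x + (1 - a) * y) + (1 - a) * x -
      (a * (a * z + (1 - a) * x) + (1 - a) * (a * y + (1 - a) * z))
      = (2 * a^2 - 2 * a + 1) * (x - z)"
    by algebra
  finally show ?thesis .
qed

lemma semisymmetric_iff:
  assumes "x \<in> Q" "y \<in> Q"
  shows "x \<cdot> (y \<cdot> x) = y \<longleftrightarrow> n dvd (a^2 - a + 1) * (x - y)"
proof -
  have eqs: "[x \<cdot> (y \<cdot> x) = a * x + (1 - a) * (a * y + (1 - a) * x)] (mod n)"
    "[y = y] (mod n)"
    by (intro mult_cong mult_closed assms cong_refl)+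
  have "x \<cdot> (y \<cdot> x) \<in> Q" "y \<in> Q"
    by (intro mult_closed assms)+
  note residue_eq_iff_dvd[OF this eqs]
  also have "a * x + (1 - a) * (a * y + (1 - a) * x) - y
      = (a^2 - a + 1) * (x - y)"
    by algebra
  finally show ?thesis .
qed

text \<open>The coefficient of \<open>y\<close> is \<open>(a * (1 - a))^2 - 1\<close>, a difference
  of squares with factor \<open>a^2 - a - 1\<close>; the coefficients of \<open>x\<close> and
  \<open>z\<close> contain the same factor.\<close>

lemma GS1_iff:
  assumes "x \<in> Q" "y \<in> Q" "z \<in> Q"
  shows "(x \<cdot> ((x \<cdot> y) \<cdot> z)) \<cdot> z = y \<longleftrightarrow>
    n dvd (a^2 - a - 1) * (- (a^2) * x + (a^2 - a + 1) * y - (1 - a) * z)"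
proof -
  have eqs: "[(x \<cdot> ((x \<cdot> y) \<cdot> z)) \<cdot> z =
      a * (a * x + (1 - a) * (a * (a * x + (1 - a) * y) + (1 - a) * z)) + (1 - a) * z] (mod n)"
    "[y = y] (mod n)"
    by (intro mult_cong mult_closed assms cong_refl)+
  have "(x \<cdot> ((x \<cdot> y) \<cdot> z)) \<cdot> z \<in> Q" "y \<in> Q"
    by (intro mult_closed assms)+
  note residue_eq_iff_dvd[OF this eqs]
  also have "a * (a * x + (1 - a) * (a * (a * x + (1 - a) * y) + (1 - a) * z)) + (1 - a) * z - y
      = (a^2 - a - 1) * (- (a^2) * x + (a^2 - a + 1) * y - (1 - a) * z)"
    by algebra
  finally show ?thesis .
qed

lemma GS2_iff:
  assumes "x \<in> Q" "y \<in> Q" "z \<in> Q"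
  shows "x \<cdot> ((x \<cdot> (y \<cdot> z)) \<cdot> z) = y \<longleftrightarrow>
    n dvd (a^2 - a - 1) * (- a * x + (a^2 - a + 1) * y - (1 - a)^2 * z)"
proof -
  have eqs: "[x \<cdot> ((x \<cdot> (y \<cdot> z)) \<cdot> z) =
      a * x + (1 - a) * (a * (a * x + (1 - a) * (a * y + (1 - a) * z)) + (1 - a) * z)] (mod n)"
    "[y = y] (mod n)"
    by (intro mult_cong mult_closed assms cong_refl)+
  have "x \<cdot> ((x \<cdot> (y \<cdot> z)) \<cdot> z) \<in> Q" "y \<in> Q"
    by (intro mult_closed assms)+
  note residue_eq_iff_dvd[OF this eqs]
  also have "a * x + (1 - a) * (a * (a * x + (1 - a) * (a * y + (1 - a) * z)) + (1 - a) * z) - y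
      = (a^2 - a - 1) * (- a * x + (a^2 - a + 1) * y - (1 - a)^2 * z)"
    by algebra
  finally show ?thesis .
qed

lemma right_modular_iff:
  assumes "x \<in> Q" "y \<in> Q" "z \<in> Q"
  shows "(x \<cdot> y) \<cdot> z = (z \<cdot> y) \<cdot> x \<longleftrightarrow> n dvd (a^2 + a - 1) * (x - z)"
proof -
  have eqs: "[(x \<cdot> y) \<cdot> z = a * (a * x + (1 - a) * y) + (1 - a) * z] (mod n)"
    "[(z \<cdot> y) \<cdot> x = a * (a * z + (1 - a) * y) + (1 - a) * x] (mod n)"
    by (intro mult_cong mult_closed assms cong_refl)+
  have "(x \<cdot> y) \<cdot> z \<in> Q" "(z \<cdot> y) \<cdot> x \<in> Q"
    by (intro mult_closed assms)+
  note residue_eq_iff_dvd[OF this eqs]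
  also have "a * (a * x + (1 - a) * y) + (1 - a) * z - (a * (a * z + (1 - a) * y) + (1 - a) * x)
      = (a^2 + a - 1) * (x - z)"
    by algebra
  finally show ?thesis .
qed

lemma left_modular_iff:
  assumes "x \<in> Q" "y \<in> Q" "z \<in> Q"
  shows "x \<cdot> (y \<cdot> z) = z \<cdot> (y \<cdot> x) \<longleftrightarrow> n dvd (a^2 - 3 * a + 1) * (z - x)"
proof -
  have eqs: "[x \<cdot> (y \<cdot> z) = a * x + (1 - a) * (a * y + (1 - a) * z)] (mod n)"
    "[z \<cdot> (y \<cdot> x) = a * z + (1 - a) * (a * y + (1 - a) * x)] (mod n)"
    by (intro mult_cong mult_closed assms cong_refl)+
  have "x \<cdot> (y \<cdot> z) \<in> Q" "z \<cdot> (y \<cdot> x) \<in> Q"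
    by (intro mult_closed assms)+
  note residue_eq_iff_dvd[OF this eqs]
  also have "a * x + (1 - a) * (a * y + (1 - a) * z) - (a * z + (1 - a) * (a * y + (1 - a) * x))
      = (a^2 - 3 * a + 1) * (z - x)"
    by algebra
  finally show ?thesis .
qed

text \<open>The resulting form is that of \<open>left_modular_iff\<close> with \<open>y\<close> in
  place of \<open>z\<close>, hence the common polynomial of the two classes.\<close>

lemma Stein_iff:
  assumes "x \<in> Q" "y \<in> Q"
  shows "x \<cdot> (x \<cdot> y) = y \<cdot> x \<longleftrightarrow> n dvd (a^2 - 3 * a + 1) * (y - x)"
proof -
  have eqs: "[x \<cdot> (x \<cdot> y) = a * x + (1 - a) * (a * x + (1 - a) * y)] (mod n)"
    "[y \<cdot> x = a * y + (1 - a) * x] (mod n)"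
    by (intro mult_cong mult_closed assms cong_refl)+
  have "x \<cdot> (x \<cdot> y) \<in> Q" "y \<cdot> x \<in> Q"
    by (intro mult_closed assms)+
  note residue_eq_iff_dvd[OF this eqs]
  also have "a * x + (1 - a) * (a * x + (1 - a) * y) - (a * y + (1 - a) * x)
      = (a^2 - 3 * a + 1) * (y - x)"
    by algebra
  finally show ?thesis .
qed

text \<open>Multiplying by \<open>y\<close> on the right scales the offset from \<open>y\<close> by
  \<open>a\<close>. The two sides are therefore \<open>y + a^2 * (x - y)\<close> and
  \<open>x - a^2 * (x - y)\<close> modulo \<open>n\<close>.\<close>

lemma ARO_iff:
  assumes "x \<in> Q" "y \<in> Q"
  shows "(x \<cdot> y) \<cdot> y = (y \<cdot> x) \<cdot> x \<longleftrightarrow> n dvd (2 * a^2 - 1) * (x - y)"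
proof -
  have eqs: "[(x \<cdot> y) \<cdot> y = a * (a * x + (1 - a) * y) + (1 - a) * y] (mod n)"
    "[(y \<cdot> x) \<cdot> x = a * (a * y + (1 - a) * x) + (1 - a) * x] (mod n)"
    by (intro mult_cong mult_closed assms cong_refl)+
  have "(x \<cdot> y) \<cdot> y \<in> Q" "(y \<cdot> x) \<cdot> x \<in> Q"
    by (intro mult_closed assms)+
  note residue_eq_iff_dvd[OF this eqs]
  also have "a * (a * x + (1 - a) * y) + (1 - a) * y - (a * (a * y + (1 - a) * x) + (1 - a) * x)
      = (2 * a^2 - 1) * (x - y)"
    by algebra
  finally show ?thesis .
qed

text \<open>Each right multiplication by \<open>y\<close> scales the offset \<open>x - y\<close> by
  \<open>a\<close>, so three of them scale it by \<open>a^3\<close>.\<close>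

lemma C3_iff:
  assumes "x \<in> Q" "y \<in> Q"
  shows "((x \<cdot> y) \<cdot> y) \<cdot> y = x \<longleftrightarrow> n dvd (a^3 - 1) * (x - y)"
proof -
  have eqs: "[((x \<cdot> y) \<cdot> y) \<cdot> y =
      a * (a * (a * x + (1 - a) * y) + (1 - a) * y) + (1 - a) * y] (mod n)"
    "[x = x] (mod n)"
    by (intro mult_cong mult_closed assms cong_refl)+
  have "((x \<cdot> y) \<cdot> y) \<cdot> y \<in> Q" "x \<in> Q"
    by (intro mult_closed assms)+
  note residue_eq_iff_dvd[OF this eqs]
  also have "a * (a * (a * x + (1 - a) * y) + (1 - a) * y) + (1 - a) * y - (x)
      = (a^3 - 1) * (x - y)"
    by algebra
  finally show ?thesis .
qed

section \<open>Characterisation of the eight classes\<close>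

lemma quadratical_quasigroup_iff: "quadratical_quasigroup Q mult \<longleftrightarrow> n dvd 2 * a^2 - 2 * a + 1"
proof
  assume "quadratical_quasigroup Q mult"
  then interpret quadratical_quasigroup Q mult .
  \<comment> \<open>The identity is evaluated at \<open>x = n\<close> and
    \<open>z = 1\<close>.\<close>
  have "n dvd (2 * a^2 - 2 * a + 1) * (n - 1)"
    using quadratical quadratical_iff one_mem n_mem by blast
  then show "n dvd 2 * a^2 - 2 * a + 1"
    by (simp only: dvd_mult_diff_self_iff)
next
  assume dvd: "n dvd 2 * a^2 - 2 * a + 1"
  \<comment> \<open>Isolating the constant term of the polynomial leaves a multiple of
    \<open>a\<close>, whose cofactor is the inverse of \<open>a\<close>. The sign of that constant
    term decides between the quotients 1 and -1; the other classes find their inverse in the same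
    way.\<close>
  also have "2 * a^2 - 2 * a + 1 dvd a * (2 - 2 * a) - 1"
    by (rule dvdI[of _ _ "-1"]) algebra
  finally have inv: "n dvd a * (2 - 2 * a) - 1" .
  show "quadratical_quasigroup Q mult"
    by (intro quadratical_quasigroup.intro quadratical_quasigroup_axioms.intro
        quasigroupI[OF inv])
      (simp_all add: quadratical_iff dvd_mult2 dvd del: atLeastAtMost_iff)
qed

lemma hexagonal_quasigroup_iff: "hexagonal_quasigroup Q mult \<longleftrightarrow> n dvd a^2 - a + 1"
proof
  assume "hexagonal_quasigroup Q mult"
  then interpret hexagonal_quasigroup Q mult .
  have "n dvd (a^2 - a + 1) * (n - 1)"
    using semisymmetric semisymmetric_iff one_mem n_mem by blast
  then show "n dvd a^2 - a + 1"
    by (simp only: dvd_mult_diff_self_iff)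
next
  assume dvd: "n dvd a^2 - a + 1"
  also have "a^2 - a + 1 dvd a * (1 - a) - 1"
    by (rule dvdI[of _ _ "-1"]) algebra
  finally have inv: "n dvd a * (1 - a) - 1" .
  show "hexagonal_quasigroup Q mult"
    by (intro hexagonal_quasigroup.intro hexagonal_quasigroup_axioms.intro
        idempotent_quasigroupI[OF inv] medial_quasigroupI[OF inv])
      (simp_all add: semisymmetric_iff dvd_mult2 dvd del: atLeastAtMost_iff)
qed

lemma GS_quasigroup_iff: "GS_quasigroup Q mult \<longleftrightarrow> n dvd a^2 - a - 1"
proof
  assume "GS_quasigroup Q mult"
  then interpret GS_quasigroup Q mult .
  \<comment> \<open>Setting \<open>x = y = n\<close> and \<open>z = 1\<close> isolates the
    coefficient of \<open>z\<close>, since the three coefficients sum to 0. What remains beside the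
    polynomial is \<open>(1 - a) * (n - 1)\<close>, a product of two units.\<close>
  have "n dvd (a^2 - a - 1) * (- (a^2) * n + (a^2 - a + 1) * n - (1 - a) * 1)"
    using GS1 GS1_iff one_mem n_mem by blast
  also have "(a^2 - a - 1) * (- (a^2) * n + (a^2 - a + 1) * n - (1 - a) * 1)
      = (1 - a) * (a^2 - a - 1) * (n - 1)"
    by algebra
  finally have "n dvd (1 - a) * (a^2 - a - 1)"
    by (simp only: dvd_mult_diff_self_iff)
  then show "n dvd a^2 - a - 1"
    using coprime_right by (simp only: coprime_dvd_mult_right_iff coprime_commute)
next
  assume dvd: "n dvd a^2 - a - 1"
  also have "a^2 - a - 1 dvd a * (a - 1) - 1"
    by (rule dvdI[of _ _ "1"]) algebra
  finally have inv: "n dvd a * (a - 1) - 1" .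
  show "GS_quasigroup Q mult"
    by (intro GS_quasigroup.intro GS_quasigroup_axioms.intro
        idempotent_quasigroupI[OF inv])
      (simp_all add: GS1_iff GS2_iff dvd_mult2 dvd del: atLeastAtMost_iff)
qed

lemma right_modular_quasigroup_iff: "right_modular_quasigroup Q mult \<longleftrightarrow> n dvd a^2 + a - 1"
proof
  assume "right_modular_quasigroup Q mult"
  then interpret right_modular_quasigroup Q mult .
  have "n dvd (a^2 + a - 1) * (n - 1)"
    using right_modular right_modular_iff one_mem n_mem by blast
  then show "n dvd a^2 + a - 1"
    by (simp only: dvd_mult_diff_self_iff)
next
  assume dvd: "n dvd a^2 + a - 1"
  also have "a^2 + a - 1 dvd a * (a + 1) - 1"
    by (rule dvdI[of _ _ "1"]) algebra
  finally have inv: "n dvd a * (a + 1) - 1" .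
  show "right_modular_quasigroup Q mult"
    by (intro right_modular_quasigroup.intro right_modular_quasigroup_axioms.intro
        quasigroupI[OF inv])
      (simp_all add: right_modular_iff dvd_mult2 dvd del: atLeastAtMost_iff)
qed

lemma left_modular_quasigroup_iff: "left_modular_quasigroup Q mult \<longleftrightarrow> n dvd a^2 - 3 * a + 1"
proof
  assume "left_modular_quasigroup Q mult"
  then interpret left_modular_quasigroup Q mult .
  have "n dvd (a^2 - 3 * a + 1) * (n - 1)"
    using left_modular left_modular_iff one_mem n_mem by blast
  then show "n dvd a^2 - 3 * a + 1"
    by (simp only: dvd_mult_diff_self_iff)
next
  assume dvd: "n dvd a^2 - 3 * a + 1"
  also have "a^2 - 3 * a + 1 dvd a * (3 - a) - 1"
    by (rule dvdI[of _ _ "-1"]) algebra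
  finally have inv: "n dvd a * (3 - a) - 1" .
  show "left_modular_quasigroup Q mult"
    by (intro left_modular_quasigroup.intro left_modular_quasigroup_axioms.intro
        quasigroupI[OF inv])
      (simp_all add: left_modular_iff dvd_mult2 dvd del: atLeastAtMost_iff)
qed

lemma Stein_quasigroup_iff: "Stein_quasigroup Q mult \<longleftrightarrow> n dvd a^2 - 3 * a + 1"
proof
  assume "Stein_quasigroup Q mult"
  then interpret Stein_quasigroup Q mult .
  have "n dvd (a^2 - 3 * a + 1) * (n - 1)"
    using Stein Stein_iff one_mem n_mem by blast
  then show "n dvd a^2 - 3 * a + 1"
    by (simp only: dvd_mult_diff_self_iff)
next
  assume dvd: "n dvd a^2 - 3 * a + 1"
  also have "a^2 - 3 * a + 1 dvd a * (3 - a) - 1"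
    by (rule dvdI[of _ _ "-1"]) algebra
  finally have inv: "n dvd a * (3 - a) - 1" .
  show "Stein_quasigroup Q mult"
    by (intro Stein_quasigroup.intro Stein_quasigroup_axioms.intro
        quasigroupI[OF inv])
      (simp_all add: Stein_iff dvd_mult2 dvd del: atLeastAtMost_iff)
qed

lemma ARO_quasigroup_iff: "ARO_quasigroup Q mult \<longleftrightarrow> n dvd 2 * a^2 - 1"
proof
  assume "ARO_quasigroup Q mult"
  then interpret ARO_quasigroup Q mult .
  have "n dvd (2 * a^2 - 1) * (n - 1)"
    using ARO ARO_iff one_mem n_mem by blast
  then show "n dvd 2 * a^2 - 1"
    by (simp only: dvd_mult_diff_self_iff)
next
  assume dvd: "n dvd 2 * a^2 - 1"
  also have "2 * a^2 - 1 dvd a * (2 * a) - 1"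
    by (rule dvdI[of _ _ "1"]) algebra
  finally have inv: "n dvd a * (2 * a) - 1" .
  show "ARO_quasigroup Q mult"
    by (intro ARO_quasigroup.intro ARO_quasigroup_axioms.intro
        idempotent_quasigroupI[OF inv] medial_quasigroupI[OF inv])
      (simp_all add: ARO_iff dvd_mult2 dvd del: atLeastAtMost_iff)
qed

lemma C3_quasigroup_iff: "C3_quasigroup Q mult \<longleftrightarrow> n dvd a^3 - 1"
proof
  assume "C3_quasigroup Q mult"
  then interpret C3_quasigroup Q mult .
  have "n dvd (a^3 - 1) * (n - 1)"
    using C3 C3_iff one_mem n_mem by blast
  then show "n dvd a^3 - 1"
    by (simp only: dvd_mult_diff_self_iff)
next
  assume dvd: "n dvd a^3 - 1"
  \<comment> \<open>Here the two terms agree outright: \<open>a^2\<close> is the inverse of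
    \<open>a\<close> when \<open>a^3\<close> is congruent to 1.\<close>
  also have "a^3 - 1 dvd a * (a^2) - 1"
    by (rule dvdI[of _ _ "1"]) algebra
  finally have inv: "n dvd a * (a^2) - 1" .
  show "C3_quasigroup Q mult"
    by (intro C3_quasigroup.intro C3_quasigroup_axioms.intro
        idempotent_quasigroupI[OF inv])
      (simp_all add: C3_iff dvd_mult2 dvd del: atLeastAtMost_iff)
qed

end

section \<open>Elimination of \<open>b\<close>, and translatability\<close>

theorem theorem4p26:
  fixes n k a b :: int and mult :: "int \<Rightarrow> int \<Rightarrow> int"
  assumes "n > 0" and "k > 0"
    and "\<And>x y. \<lbrakk>x \<in> {1..n}; y \<in> {1..n}\<rbrakk> \<Longrightarrow> mult x y = residue_rep n (a * x + b * y)"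
    and "[a + b = 1] (mod n)" and "[a + b * k = 0] (mod n)"
  shows "k_translatable_groupoid n k mult \<and>
    (quadratical_quasigroup {1..n} mult \<longleftrightarrow> [2 * a^2 - 2 * a + 1 = 0] (mod n)) \<and>
    (hexagonal_quasigroup {1..n} mult \<longleftrightarrow> [a^2 - a + 1 = 0] (mod n)) \<and>
    (GS_quasigroup {1..n} mult \<longleftrightarrow> [a^2 - a - 1 = 0] (mod n)) \<and>
    (right_modular_quasigroup {1..n} mult \<longleftrightarrow> [a^2 + a - 1 = 0] (mod n)) \<and>
    (left_modular_quasigroup {1..n} mult \<longleftrightarrow> [a^2 - 3 * a + 1 = 0] (mod n)) \<and>
    (Stein_quasigroup {1..n} mult \<longleftrightarrow> [a^2 - 3 * a + 1 = 0] (mod n)) \<and>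
    (ARO_quasigroup {1..n} mult \<longleftrightarrow> [2 * a^2 = 1] (mod n)) \<and>
    (C3_quasigroup {1..n} mult \<longleftrightarrow> [a^3 = 1] (mod n))"
proof -
  have b: "[b = 1 - a] (mod n)"
    using assms(4) by (simp add: cong_iff_dvd_diff algebra_simps)
  have "[(1 - a) * (1 - k) = b * (1 - k)] (mod n)"
    using b by (intro cong_mult cong_refl) (rule cong_sym)
  also have "b * (1 - k) = (a + b) - (a + b * k)"
    by algebra
  also have "[\<dots> = 1 - 0] (mod n)"
    using assms(4,5) by (rule cong_diff)
  finally have coprime: "coprime (1 - a) n"
    by (intro coprime_if_dvd_diff_one) (simp add: cong_iff_dvd_diff)
  have "mult x y = residue_rep n (a * x + (1 - a) * y)" if "x \<in> {1..n}" "y \<in> {1..n}" for x y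
    unfolding assms(3)[OF that] using b
    by (intro residue_rep_cong_eq cong_add cong_mult cong_refl)
  then interpret affine_groupoid n a mult
    using assms(1) coprime by unfold_locales
  have "k_translatable_groupoid n k mult"
  proof
    fix i j assume ij: "i \<in> {1..n}" "j \<in> {1..n}"
    \<comment> \<open>Shifting \<open>i\<close> by 1 and \<open>j\<close> by \<open>k\<close> adds
      \<open>a + b * k\<close> to the linear form, which is 0 modulo \<open>n\<close>; the explicit
      \<open>0\<close> is the summand that it replaces.\<close>
    have "[a * i + b * j + 0 = a * i + b * j + (a + b * k)] (mod n)"
      using assms(5) by (intro cong_add cong_refl) (rule cong_sym)
    also have "a * i + b * j + (a + b * k) = a * (i + 1) + b * (j + k)"
      by algebra
    also have "[\<dots> = a * residue_rep n (i + 1) + b * residue_rep n (j + k)] (mod n)"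
      using residue_rep_cong[OF assms(1)]
      by (intro cong_add cong_mult cong_refl) (blast intro: cong_sym)+
    finally show "mult i j = mult (residue_rep n (i + 1)) (residue_rep n (j + k))"
      using ij by (simp add: assms(3) residue_rep_mem[OF assms(1)] residue_rep_cong_eq
          del: atLeastAtMost_iff)
  qed (rule mult_closed)
  then show ?thesis
    by (simp add: cong_iff_dvd_diff quadratical_quasigroup_iff hexagonal_quasigroup_iff
        GS_quasigroup_iff right_modular_quasigroup_iff left_modular_quasigroup_iff
        Stein_quasigroup_iff ARO_quasigroup_iff C3_quasigroup_iff)
qed

end
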